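(* Let $F(\mathbf{x})=\mathbb{E}_{\mathbf{z}\sim P}[\tilde F(\mathbf{x},\mathbf{z})]$, $F:\mathcal{X}\to\mathbb{R}_+$, be differentiable, monotone and DR-submodular with $L$-Lipschitz gradient on $\mathcal{X}$, i.e. $\|\nabla F(\mathbf{x})-\nabla F(\mathbf{y})\|\le L\|\mathbf{x}-\mathbf{y}\|$ for all $\mathbf{x},\mathbf{y}\in\mathcal{X}$. Let $\mathcal{C}\subseteq\mathcal{X}$ be a convex body with $\|\mathbf{x}\|\le D$ for all $\mathbf{x}\in\mathcal{C}$. Suppose the stochastic gradients are unbiased, $\mathbb{E}[\nabla\tilde F(\mathbf{x},\mathbf{z})]=\nabla F(\mathbf{x})$, and satisfy $\mathbb{E}[\|\nabla\tilde F(\mathbf{x},\mathbf{z})-\nabla F(\mathbf{x})\|^2]\le\sigma^2$ for all $\mathbf{x}\in\mathcal{X}$. Let $T\ge1$ be an integer and run Stochastic Continuous Greedy (SCG, defined in the context) for $T$ steps with $\rho_t=\frac{4}{(t+8)^{2/3}}$. Then $$\mathbb{E}[F(\mathbf{x}_T)]\ \ge\ (1-1/e)\,\mathrm{OPT}-\frac{2DQ^{1/2}}{T^{1/3}}-\frac{LD^2}{2T},$$ where $\mathrm{OPT}=\max_{\mathbf{x}\in\mathcal{C}}F(\mathbf{x})$ and $Q=\max\{9^{2/3}\|\nabla F(\mathbf{x}_0)-\mathbf{d}_0\|^2,\ 16\sigma^2+3L^2D^2\}$.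
   Context: Norms are Euclidean and vector inequalities are componentwise. The domain is a box $\mathcal{X}=\prod_{i=1}^n\mathcal{X}_i$ with each $\mathcal{X}_i\subset\mathbb{R}_+$ a compact interval containing $0$. A convex body $\mathcal{C}\subseteq\mathcal{X}$ is a nonempty compact convex set; it need not be down-closed nor contain $\mathbf{0}$. $F:\mathcal{X}\to\mathbb{R}_+$ is monotone if $\mathbf{x}\le\mathbf{y}\Rightarrow F(\mathbf{x})\le F(\mathbf{y})$. It is submodular if $F(\mathbf{x})+F(\mathbf{y})\ge F(\mathbf{x}\vee\mathbf{y})+F(\mathbf{x}\wedge\mathbf{y})$ for all $\mathbf{x},\mathbf{y}\in\mathcal{X}$ (componentwise max and min). A differentiable submodular $F$ is DR-submodular if $\mathbf{x}\le\mathbf{y}\Rightarrow\nabla F(\mathbf{x})\ge\nabla F(\mathbf{y})$. Only $F$, not the individual functions $\tilde F(\cdot,\mathbf{z})$, is assumed monotone and DR-submodular. SCG: set $\mathbf{d}_0=\mathbf{x}_0=\mathbf{0}$. With $\mathbf{z}_1,\mathbf{z}_2,\dots$ i.i.d. samples from $P$ and parameters $\rho_t>0$, define $\mathbf{d}_t=(1-\rho_t)\mathbf{d}_{t-1}+\rho_t\nabla\tilde F(\mathbf{x}_t,\mathbf{z}_t)$ for $t=1,\dots,T$; and for $t=0,\dots,T-1$: $\mathbf{v}_t\in\arg\max_{\mathbf{v}\in\mathcal{C}}\mathbf{d}_t^{T}\mathbf{v}$ (ties broken arbitrarily, depending only on the past; in particular $\mathbf{v}_0$ is any point of $\mathcal{C}$)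 and $\mathbf{x}_{t+1}=\mathbf{x}_t+\frac1T\mathbf{v}_t$. *)

theory Defs
  imports "HOL-Probability.Probability"
begin

text \<open>
  Differentiability is relative to \<^term>\<open>X\<close>, so at boundary points of a closed box only
  increments staying inside the box matter. On a box with nonempty interior \<^term>\<open>gF\<close> is
  uniquely determined on \<^term>\<open>X\<close>.
\<close>

definition gradient_on ::
  "(real^'n) set \<Rightarrow> (real^'n \<Rightarrow> real) \<Rightarrow> (real^'n \<Rightarrow> real^'n) \<Rightarrow> bool" where
  "gradient_on X F gF \<longleftrightarrow>
     (\<forall>x\<in>X. (F has_derivative (\<lambda>h. gF x \<bullet> h)) (at x within X))"

text \<open>The order and the lattice operations of \<^typ>\<open>real^'n\<close> are componentwise.\<close>

definition submodular_on :: "(real^'n) set \<Rightarrow> (real^'n \<Rightarrow> real) \<Rightarrow> bool" where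
  "submodular_on X F \<longleftrightarrow> (\<forall>x\<in>X. \<forall>y\<in>X. F x + F y \<ge> F (sup x y) + F (inf x y))"

definition DR_submodular_on ::
  "(real^'n) set \<Rightarrow> (real^'n \<Rightarrow> real) \<Rightarrow> (real^'n \<Rightarrow> real^'n) \<Rightarrow> bool" where
  "DR_submodular_on X F gF \<longleftrightarrow>
     submodular_on X F \<and> gradient_on X F gF \<and> (\<forall>x\<in>X. \<forall>y\<in>X. x \<le> y \<longrightarrow> gF x \<ge> gF y)"

text \<open>
  One sample path of Stochastic Continuous Greedy: \<^term>\<open>g\<close> is the stochastic gradient,
  \<^term>\<open>\<rho>\<close> the averaging parameters, and \<^term>\<open>z\<close> the realized samples
  (\<^term>\<open>z 0\<close> is unused). Ties in the linear maximization are left unresolved here.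
\<close>

definition scg_run ::
  "(real^'n \<Rightarrow> 'z \<Rightarrow> real^'n) \<Rightarrow> (real^'n) set \<Rightarrow> nat \<Rightarrow> (nat \<Rightarrow> real) \<Rightarrow> (nat \<Rightarrow> 'z) \<Rightarrow>
   (nat \<Rightarrow> real^'n) \<Rightarrow> (nat \<Rightarrow> real^'n) \<Rightarrow> (nat \<Rightarrow> real^'n) \<Rightarrow> bool" where
  "scg_run g C T \<rho> z d v x \<longleftrightarrow>
     d 0 = 0 \<and> x 0 = 0 \<and>
     (\<forall>t\<in>{1..T}. d t = (1 - \<rho> t) *\<^sub>R d (t - 1) + \<rho> t *\<^sub>R g (x t) (z t)) \<and>
     (\<forall>t<T. is_arg_max (\<lambda>w. d t \<bullet> w) (\<lambda>w. w \<in> C) (v t)) \<and>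
     (\<forall>t<T. x (t + 1) = x t + (1 / real T) *\<^sub>R v t)"

text \<open>The initial points \<^term>\<open>x0\<close> and \<^term>\<open>d0\<close> of the algorithm are zero.\<close>

definition scg_Q :: "(real^'n \<Rightarrow> real^'n) \<Rightarrow> real \<Rightarrow> real \<Rightarrow> real \<Rightarrow> real" where
  "scg_Q gF L D \<sigma> =
     (let x0 = 0; d0 = 0
      in max (9 powr (2/3) * (norm (gF x0 - d0))\<^sup>2) (16 * \<sigma>\<^sup>2 + 3 * L\<^sup>2 * D\<^sup>2))"

end

theory Submission
  imports Defs
begin

text \<open>
  Write \<open>Q\<close> for \<^term>\<open>scg_Q gF L D \<sigma>\<close> and \<open>a\<^sub>t\<close> for the mean square of \<open>\<nabla>F(x\<^sub>t) - d\<^sub>t\<close>. The fresh sample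
  of round \<open>t + 1\<close> is independent of the past, so the noise is orthogonal to the rest and
  \<open>a\<^bsub>t+1\<^esub> \<le> (1 - \<rho>\<^bsub>t+1\<^esub>) a\<^sub>t + 2 L\<^sup>2 D\<^sup>2 / (\<rho>\<^bsub>t+1\<^esub> T\<^sup>2) + \<rho>\<^bsub>t+1\<^esub>\<^sup>2 \<sigma>\<^sup>2\<close>. For \<open>T \<ge> 8\<close> this gives
  \<open>a\<^sub>t \<le> (4/9) Q (t + 2)\<^bsup>-2/3\<^esup>\<close>. DR-submodularity and smoothness bound the gap to any \<open>y \<in> C\<close> after
  one step by \<open>1 - 1/T\<close> times the previous gap plus \<open>(2 D / T) sqrt a\<^sub>t + L D\<^sup>2 / (2 T\<^sup>2)\<close>, and the
  errors sum up to at most \<open>2 D sqrt Q / T\<^bsup>1/3\<^esup> + L D\<^sup>2 / (2 T)\<close>. For \<open>T < 8\<close> the drift estimate is not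
  available, but there the bound is trivial: \<open>F(y) - F(0) \<le> D |\<nabla>F(0)| \<le> D sqrt Q\<close>, which is at
  most \<open>2 D sqrt Q / T\<^bsup>1/3\<^esup>\<close>.
\<close>

subsection \<open>DR-submodular functions on a box\<close>

text \<open>Chain rule along a segment. \<open>F\<close> is differentiable only relative to
  \<open>X\<close>, so the derivative in \<open>s\<close> is taken within \<open>{0..1}\<close>,
  one-sided at the ends.\<close>

lemma gradient_on_segment:
  fixes F :: "real^'n \<Rightarrow> real"
  assumes "gradient_on X F gF" "convex X" "x \<in> X" "x + h \<in> X" "0 \<le> s" "s \<le> 1"
  shows "((\<lambda>s. F (x + s *\<^sub>R h)) has_derivative (\<lambda>r. r * (gF (x + s *\<^sub>R h) \<bullet> h))) (at s within {0..1})"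
proof -
  define p where "p s = x + s *\<^sub>R h" for s :: real
  have pX: "p s \<in> X" if "s \<in> {0..1}" for s
  proof -
    have "p s = (1 - s) *\<^sub>R x + s *\<^sub>R (x + h)" by (simp add: p_def algebra_simps)
    then show ?thesis using assms(2-4) that by (simp add: convex_alt)
  qed
  have F: "(F has_derivative (\<lambda>h. gF (p s) \<bullet> h)) (at (p s) within X)"
    using assms pX by (simp add: gradient_on_def)
  have "(F has_derivative (\<lambda>h. gF (p s) \<bullet> h)) (at (p s) within p ` {0..1})"
    by (rule has_derivative_subset[OF F]) (use pX in auto)
  moreover have "(p has_derivative (\<lambda>r. r *\<^sub>R h)) (at s within {0..1})"
    unfolding p_def by (auto intro!: derivative_eq_intros)
  ultimately have "((\<lambda>s. F (p s)) has_derivative (\<lambda>r. gF (p s) \<bullet> (r *\<^sub>R h))) (at s within {0..1})"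
    by (rule has_derivative_in_compose[rotated])
  then show ?thesis by (simp add: p_def)
qed

lemma smooth_lower_bound:
  fixes F :: "real^'n \<Rightarrow> real"
  assumes grad: "gradient_on X F gF" and "convex X" and lip: "L-lipschitz_on X gF"
    and xy: "x \<in> X" "y \<in> X"
  shows "F x + gF x \<bullet> (y - x) - L / 2 * (norm (y - x))\<^sup>2 \<le> F y"
proof -
  define h where "h = y - x"
  define p where "p s = x + s *\<^sub>R h" for s :: real
  have pX: "p s \<in> X" if "0 \<le> s" "s \<le> 1" for s
  proof -
    have "p s = (1 - s) *\<^sub>R x + s *\<^sub>R y" by (simp add: p_def h_def algebra_simps)
    then show ?thesis using assms that by (simp add: convex_alt)
  qed
  \<comment> \<open>The derivative \<open>L * s * (norm h)\<^sup>2\<close> of the quadratic term is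
    the most by which \<open>gF (p s) \<bullet> h\<close> can differ from
    \<open>gF x \<bullet> h\<close>. Hence \<open>\<phi>' s 1\<close> is nonnegative, and the claim
    is \<open>\<phi> 0 \<le> \<phi> 1\<close>.\<close>
  define \<phi> where "\<phi> s = F (p s) - s * (gF x \<bullet> h) + L / 2 * s\<^sup>2 * (norm h)\<^sup>2" for s
  define \<phi>' where "\<phi>' s r = r * (gF (p s) \<bullet> h) - r * (gF x \<bullet> h) + L * s * (norm h)\<^sup>2 * r" for s r
  have der: "(\<phi> has_derivative \<phi>' s) (at s within {0..1})" if "0 \<le> s" "s \<le> 1" for s
  proof -
    have "((\<lambda>s. F (p s)) has_derivative (\<lambda>r. r * (gF (p s) \<bullet> h))) (at s within {0..1})"
      unfolding p_def using that xy by (intro gradient_on_segment[OF grad \<open>convex X\<close>]) (auto simp: h_def)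
    then show ?thesis unfolding \<phi>_def
      by (auto intro!: derivative_eq_intros simp: \<phi>'_def fun_eq_iff power2_eq_square)
  qed
  obtain s where s: "s \<in> {0..1}" "\<phi> 1 - \<phi> 0 = \<phi>' s (1 - 0)"
    using mvt_very_simple[of 0 1 \<phi>, OF _ der] by auto
  have "norm (gF (p s) - gF x) \<le> L * norm (p s - x)"
    using lipschitz_onD[OF lip pX xy(1)] s by (simp add: dist_norm)
  also have "norm (p s - x) = s * norm h" using s by (simp add: p_def)
  finally have "norm (gF (p s) - gF x) * norm h \<le> L * (s * norm h) * norm h"
    by (rule mult_right_mono) simp
  then have "\<bar>(gF (p s) - gF x) \<bullet> h\<bar> \<le> L * s * (norm h)\<^sup>2"
    using Cauchy_Schwarz_ineq2[of "gF (p s) - gF x" h] by (simp add: power2_eq_square algebra_simps)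
  then have "0 \<le> \<phi>' s 1" by (simp add: \<phi>'_def inner_diff_left)
  then show ?thesis using s by (simp add: \<phi>_def p_def h_def)
qed

text \<open>Concavity along nonnegative directions: the gradient at the mean value point lies below
  \<open>gF x\<close>, and it is paired with \<open>y - x \<ge> 0\<close>.\<close>

lemma DR_submodular_upper_bound:
  fixes F :: "real^'n \<Rightarrow> real"
  assumes DR: "DR_submodular_on X F gF" and "convex X" and xy: "x \<in> X" "y \<in> X" "x \<le> y"
  shows "F y - F x \<le> gF x \<bullet> (y - x)"
proof -
  from DR have "gradient_on X F gF" by (simp add: DR_submodular_on_def)
  from mvt_very_simple[of 0 1 "\<lambda>s. F (x + s *\<^sub>R (y - x))", OF _ gradient_on_segment[OF this \<open>convex X\<close> xy(1)]]
  obtain s where s: "0 \<le> s" "s \<le> 1" "F y - F x = gF (x + s *\<^sub>R (y - x)) \<bullet> (y - x)"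
    using xy by auto
  have "x + s *\<^sub>R (y - x) = (1 - s) *\<^sub>R x + s *\<^sub>R y" by (simp add: algebra_simps)
  with \<open>convex X\<close> s xy have "x + s *\<^sub>R (y - x) \<in> X" by (simp add: convex_alt)
  moreover have "x \<le> x + s *\<^sub>R (y - x)" using s xy by (simp add: scaleR_nonneg_nonneg)
  ultimately have "gF (x + s *\<^sub>R (y - x)) \<le> gF x"
    using DR xy by (simp add: DR_submodular_on_def)
  then have "0 \<le> (gF x - gF (x + s *\<^sub>R (y - x))) \<bullet> (y - x)"
    using xy by (intro inner_nonneg_nonneg) auto
  then show ?thesis using s by (simp add: inner_diff_left)
qed

text \<open>Walking back from \<open>x\<close> by \<open>s *\<^sub>R w\<close> cannot increase a
  monotone \<open>F\<close>. A negative pairing would give a gain \<open>s * a\<close> of first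
  order against a loss of at most \<open>s * (s * b)\<close>, impossible for small
  \<open>s\<close>.\<close>

lemma mono_gradient_inner_nonneg:
  fixes F :: "real^'n \<Rightarrow> real"
  assumes "gradient_on X F gF" "convex X" "L-lipschitz_on X gF" "mono_on X F"
    and w: "x \<in> X" "x - w \<in> X" "0 \<le> w"
  shows "0 \<le> gF x \<bullet> w"
proof (rule ccontr)
  define a where "a = - (gF x \<bullet> w)"
  define b where "b = L / 2 * (norm w)\<^sup>2"
  assume "\<not> ?thesis"
  then have a: "0 < a" by (simp add: a_def)
  have b: "0 \<le> b" using lipschitz_on_nonneg[OF assms(3)] by (simp add: b_def)
  have *: "a \<le> s * b" if s: "0 < s" "s \<le> 1" for s
  proof -
    have "x - s *\<^sub>R w = (1 - s) *\<^sub>R x + s *\<^sub>R (x - w)" by (simp add: algebra_simps)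
    then have X: "x - s *\<^sub>R w \<in> X" using assms(2) s w by (simp add: convex_alt)
    have "F (x - s *\<^sub>R w) \<le> F x"
      using assms(4) X w s by (intro mono_onD[OF assms(4)]) (auto simp: scaleR_nonneg_nonneg)
    with smooth_lower_bound[OF assms(1-3) w(1) X] have "s * a \<le> s * (s * b)"
      using s by (simp add: a_def b_def power_mult_distrib algebra_simps power2_eq_square)
    then show ?thesis using s by simp
  qed
  \<comment> \<open>Small enough that \<open>s * b < a\<close>; \<open>b + 1\<close> avoids division
    by zero, and the minimum with 1 keeps the point on the segment.\<close>
  define s where "s = min 1 (a / (2 * (b + 1)))"
  have "0 < s" "s \<le> 1" using a b by (auto simp: s_def)
  then have "a \<le> s * b" by (rule *)
  also have "\<dots> \<le> (a / (2 * (b + 1))) * b" using b by (intro mult_right_mono) (auto simp: s_def)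
  also have "\<dots> = a * (b / (2 * (b + 1)))" by simp
  also have "\<dots> < a * 1" using a b by (intro mult_strict_left_mono) auto
  finally show False by simp
qed

text \<open>
  Here \<^term>\<open>y = (sup x y - x) + inf x y\<close>: the first summand is a nonnegative direction along which
  \<^term>\<open>F\<close> is concave, and the segment from \<^term>\<open>x\<close> back to \<^term>\<open>x - inf x y\<close> stays in the
  box, so the gradient pairs nonnegatively with the second one.
\<close>
lemma DR_submodular_gap:
  fixes F :: "real^'n \<Rightarrow> real"
  assumes X: "X = cbox 0 u"
    and DR: "DR_submodular_on X F gF" and lip: "L-lipschitz_on X gF" and mono: "mono_on X F"
    and x: "x \<in> X" and y: "y \<in> X"
  shows "F y - F x \<le> gF x \<bullet> y"
proof -
  have cvx: "convex X" using X by simp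
  have grad: "gradient_on X F gF" using DR by (simp add: DR_submodular_on_def)
  have bnd: "0 \<le> x" "x \<le> u" "0 \<le> y" "y \<le> u" using x y by (auto simp: X cbox_interval)
  have s: "sup x y \<in> X" using bnd by (auto simp: X cbox_interval le_supI1)
  have i: "x - inf x y \<in> X" "0 \<le> inf x y"
    using bnd by (auto simp: X cbox_interval intro: order_trans[of _ "x - 0"] diff_mono)
  have "y = (sup x y - x) + inf x y"
    by (simp add: vec_eq_iff sup_vec_def inf_vec_def) (simp add: sup_real_def inf_real_def max_def min_def)
  then have "gF x \<bullet> y = gF x \<bullet> (sup x y - x) + gF x \<bullet> inf x y"
    by (metis inner_add_right)
  moreover have "F y \<le> F (sup x y)" by (rule mono_onD[OF mono y s]) simp
  moreover have "F (sup x y) - F x \<le> gF x \<bullet> (sup x y - x)"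
    by (rule DR_submodular_upper_bound[OF DR cvx x s]) simp
  moreover have "0 \<le> gF x \<bullet> inf x y"
    by (rule mono_gradient_inner_nonneg[OF grad cvx lip mono x i])
  ultimately show ?thesis by linarith
qed

text \<open>Since \<open>d \<bullet> y \<le> d \<bullet> v\<close>, the value
  \<open>gF x \<bullet> v\<close> falls short of \<open>gF x \<bullet> y\<close> by at most
  \<open>(gF x - d) \<bullet> (y - v)\<close>, where \<open>norm (y - v) \<le> 2 * D\<close>. By
  \<open>DR_submodular_gap\<close>, a step along \<open>v\<close> then closes a fraction
  \<open>h\<close> of the gap up to this error and the smoothness loss.\<close>

lemma greedy_step:
  fixes F :: "real^'n \<Rightarrow> real"
  assumes X: "X = cbox 0 u"
    and DR: "DR_submodular_on X F gF" and lip: "L-lipschitz_on X gF" and mono: "mono_on X F"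
    and C: "C \<subseteq> X" "\<And>y. y \<in> C \<Longrightarrow> norm y \<le> D"
    and v: "is_arg_max (\<lambda>w. d \<bullet> w) (\<lambda>w. w \<in> C) v"
    and x: "x \<in> X" "x + h *\<^sub>R v \<in> X" and y: "y \<in> C" and h: "0 \<le> h"
  shows "F y - F (x + h *\<^sub>R v) \<le>
    (1 - h) * (F y - F x) + 2 * D * h * norm (gF x - d) + L * D\<^sup>2 * h\<^sup>2 / 2"
proof -
  have vC: "v \<in> C" "d \<bullet> y \<le> d \<bullet> v" using v y by (auto simp: is_arg_max_def not_less)
  have L: "0 \<le> L" by (rule lipschitz_on_nonneg[OF lip])
  have "(gF x - d) \<bullet> (y - v) \<le> norm (gF x - d) * norm (y - v)" by (rule norm_cauchy_schwarz)
  also have "\<dots> \<le> norm (gF x - d) * (2 * D)"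
    using C(2)[OF y] C(2)[OF vC(1)] norm_triangle_ineq4[of y v] by (intro mult_left_mono) auto
  finally have "F y - F x - 2 * D * norm (gF x - d) \<le> gF x \<bullet> v"
    using DR_submodular_gap[OF X DR lip mono x(1), of y] y C(1) vC(2)
    by (auto simp: inner_diff_left inner_diff_right algebra_simps)
  then have "h * (F y - F x - 2 * D * norm (gF x - d)) \<le> h * (gF x \<bullet> v)"
    using h by (rule mult_left_mono)
  moreover have "L / 2 * (norm (h *\<^sub>R v))\<^sup>2 \<le> L / 2 * (h * D)\<^sup>2"
    using C(2)[OF vC(1)] h L by (intro mult_left_mono power_mono) (auto simp: mult_left_mono)
  moreover have "F x + gF x \<bullet> (h *\<^sub>R v) - L / 2 * (norm (h *\<^sub>R v))\<^sup>2 \<le> F (x + h *\<^sub>R v)"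
    using smooth_lower_bound[of X F gF L x "x + h *\<^sub>R v"] DR lip x
    by (simp add: DR_submodular_on_def X)
  ultimately show ?thesis by (simp add: algebra_simps power_mult_distrib)
qed

subsection \<open>Conditioning on independent samples\<close>

text \<open>
  Stated for extended nonnegative integrals, so that conditioning on the past needs no
  integrability.
\<close>
lemma (in prob_space) nn_integral_past:
  fixes z :: "'i \<Rightarrow> 'a \<Rightarrow> 'c"
  defines "past \<equiv> \<lambda>A P. vimage_algebra (space M) (\<lambda>\<omega>. \<lambda>s\<in>A. z s \<omega>) (PiM A (\<lambda>_. P))"
  assumes ind: "indep_vars (\<lambda>_. P) z I" and A: "A \<subseteq> I" "k \<in> I" "k \<notin> A"
    and h: "h \<in> borel_measurable (past A P \<Otimes>\<^sub>M P)"
  shows "(\<integral>\<^sup>+\<omega>. h (\<omega>, z k \<omega>) \<partial>M) = (\<integral>\<^sup>+\<omega>. (\<integral>\<^sup>+\<zeta>. h (\<omega>, \<zeta>) \<partial>distr M P (z k)) \<partial>M)"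
proof -
  let ?Z = "\<lambda>\<omega>. \<lambda>s\<in>A. z s \<omega>" and ?N = "PiM A (\<lambda>_. P)"
  let ?z = "\<lambda>\<omega>. \<lambda>s\<in>{k}. z s \<omega>" and ?K = "PiM {k} (\<lambda>_. P)"
  define S where "S = past A P"
  have i: "indep_var ?N ?Z ?K ?z"
    using A by (intro indep_var_restrict[OF ind]) auto
  then have Z: "?Z \<in> measurable M ?N" by (rule indep_var_rv1)
  have zk: "z k \<in> measurable M P" using ind A(2) by (auto simp: indep_vars_def)
  have X: "(\<lambda>\<omega>. \<omega>) \<in> measurable M S"
    unfolding S_def past_def by (rule measurable_vimage_algebra2) (use Z in auto)
  interpret Y: prob_space "distr M P (z k)" by (rule prob_space_distr[OF zk])
  interpret X: prob_space "distr M S (\<lambda>\<omega>. \<omega>)" by (rule prob_space_distr[OF X])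
  \<comment> \<open>The past and the fresh sample have a product joint law; it suffices to check
    rectangles, whose first side is a preimage \<open>B'\<close> under the sample tuple.\<close>
  have eq: "distr M S (\<lambda>\<omega>. \<omega>) \<Otimes>\<^sub>M distr M P (z k) = distr M (S \<Otimes>\<^sub>M P) (\<lambda>\<omega>. (\<omega>, z k \<omega>))"
  proof (rule pair_measure_eqI)
    fix B E assume BE: "B \<in> sets (distr M S (\<lambda>\<omega>. \<omega>))" "E \<in> sets (distr M P (z k))"
    then have BE': "B \<in> sets S" "E \<in> sets P" by auto
    then obtain B' where B': "B' \<in> sets ?N" "B = ?Z -` B' \<inter> space M"
      using measurable_space[OF Z] by (auto simp: S_def past_def sets_vimage_algebra2)
    \<comment> \<open>Independence is available for tuples over \<open>A\<close> and over
      \<open>{k}\<close>, so \<open>E\<close> is lifted to the one-coordinate product.\<close>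
    define E' where "E' = (\<lambda>p. p k) -` E \<inter> space ?K"
    have "(\<lambda>p. p k) \<in> measurable ?K P" by (rule measurable_component_singleton) simp
    then have E': "E' \<in> sets ?K" unfolding E'_def using BE'(2) by (rule measurable_sets)
    have E'_eq: "?z -` E' \<inter> space M = z k -` E \<inter> space M"
      using measurable_space[OF zk] by (auto simp: E'_def space_PiM PiE_def)
    have "prob ((\<lambda>\<omega>. (?Z \<omega>, ?z \<omega>)) -` (B' \<times> E') \<inter> space M)
        = prob (?Z -` B' \<inter> space M) * prob (?z -` E' \<inter> space M)"
      by (rule indep_varD[OF i B'(1) E'])
    also have "(\<lambda>\<omega>. (?Z \<omega>, ?z \<omega>)) -` (B' \<times> E') \<inter> space M
        = (\<lambda>\<omega>. (\<omega>, z k \<omega>)) -` (B \<times> E) \<inter> space M"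
      using E'_eq unfolding B' by blast
    also have "?Z -` B' \<inter> space M = (\<lambda>\<omega>. \<omega>) -` B \<inter> space M" unfolding B' by blast
    also note E'_eq
    finally show "emeasure (distr M S (\<lambda>\<omega>. \<omega>)) B * emeasure (distr M P (z k)) E
        = emeasure (distr M (S \<Otimes>\<^sub>M P) (\<lambda>\<omega>. (\<omega>, z k \<omega>))) (B \<times> E)"
      using X zk BE' by (simp add: emeasure_distr emeasure_eq_measure ennreal_mult')
  qed (auto cong: sets_pair_measure_cong intro: X.sigma_finite_measure_axioms Y.sigma_finite_measure_axioms)
  have h: "h \<in> borel_measurable (S \<Otimes>\<^sub>M P)" using h by (simp add: S_def)
  then have h': "h \<in> borel_measurable (S \<Otimes>\<^sub>M distr M P (z k))"
    "h \<in> borel_measurable (distr M S (\<lambda>\<omega>. \<omega>) \<Otimes>\<^sub>M distr M P (z k))"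
    by (simp_all cong: measurable_cong_sets sets_pair_measure_cong)
  have "(\<integral>\<^sup>+\<omega>. h (\<omega>, z k \<omega>) \<partial>M) = (\<integral>\<^sup>+p. h p \<partial>distr M (S \<Otimes>\<^sub>M P) (\<lambda>\<omega>. (\<omega>, z k \<omega>)))"
    using X zk h by (simp add: nn_integral_distr)
  also have "\<dots> = (\<integral>\<^sup>+\<omega>. (\<integral>\<^sup>+\<zeta>. h (\<omega>, \<zeta>) \<partial>distr M P (z k)) \<partial>distr M S (\<lambda>\<omega>. \<omega>))"
    unfolding eq[symmetric] by (rule Y.nn_integral_fst[OF h'(2), symmetric])
  also have "\<dots> = (\<integral>\<^sup>+\<omega>. (\<integral>\<^sup>+\<zeta>. h (\<omega>, \<zeta>) \<partial>distr M P (z k)) \<partial>M)"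
    by (intro nn_integral_distr[OF X] Y.borel_measurable_nn_integral_fst h')
  finally show ?thesis .
qed

text \<open>In the expanded square the cross term is linear in the centred noise and has mean zero.
  The constant \<open>a\<close> stands for what the past determines.\<close>

lemma (in prob_space) nn_integral_norm_add_noise_le:
  fixes Y :: "'a \<Rightarrow> 'b :: euclidean_space"
  assumes "has_bochner_integral M Y m"
    and var: "integrable M (\<lambda>\<omega>. (norm (Y \<omega> - m))\<^sup>2)" "(\<integral>\<omega>. (norm (Y \<omega> - m))\<^sup>2 \<partial>M) \<le> s"
  shows "(\<integral>\<^sup>+\<omega>. ennreal ((norm (a + r *\<^sub>R (m - Y \<omega>)))\<^sup>2) \<partial>M) \<le> ennreal ((norm a)\<^sup>2 + r\<^sup>2 * s)"
proof -
  have Y: "integrable M Y" "(\<integral>\<omega>. Y \<omega> \<partial>M) = m"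
    using assms(1) by (auto simp: has_bochner_integral_iff)
  have eq: "(norm (a + r *\<^sub>R (m - Y \<omega>)))\<^sup>2
      = (norm a)\<^sup>2 + 2 * r * (a \<bullet> (m - Y \<omega>)) + r\<^sup>2 * (norm (Y \<omega> - m))\<^sup>2" for \<omega>
    unfolding power2_norm_eq_inner inner_add_left inner_add_right inner_diff_left inner_diff_right
      inner_scaleR_left inner_scaleR_right
    by (simp add: inner_commute algebra_simps power2_eq_square)
  have int: "integrable M (\<lambda>\<omega>. (norm (a + r *\<^sub>R (m - Y \<omega>)))\<^sup>2)"
    unfolding eq using Y(1) var(1) by auto
  have "(\<integral>\<omega>. (norm (a + r *\<^sub>R (m - Y \<omega>)))\<^sup>2 \<partial>M)
      = (norm a)\<^sup>2 + 2 * r * (a \<bullet> (m - m)) + r\<^sup>2 * (\<integral>\<omega>. (norm (Y \<omega> - m))\<^sup>2 \<partial>M)"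
    unfolding eq using Y var(1) by (simp add: prob_space)
  also have "\<dots> \<le> (norm a)\<^sup>2 + r\<^sup>2 * s" using var(2) by (simp add: mult_left_mono)
  finally show ?thesis by (subst nn_integral_eq_integral[OF int]) (auto intro: ennreal_leI)
qed

text \<open>Nonnegativity of the variance. The extended integral in the hypothesis also yields
  integrability.\<close>

lemma (in prob_space) expectation_le_sqrt:
  fixes Y :: "'a \<Rightarrow> real"
  assumes Y: "Y \<in> borel_measurable M" and "(\<integral>\<^sup>+\<omega>. ennreal ((Y \<omega>)\<^sup>2) \<partial>M) \<le> ennreal b" "0 \<le> b"
  shows "integrable M Y" "(\<integral>\<omega>. Y \<omega> \<partial>M) \<le> sqrt b"
proof -
  have fin: "(\<integral>\<^sup>+\<omega>. ennreal ((Y \<omega>)\<^sup>2) \<partial>M) < \<infinity>"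
    using order_le_less_trans[OF assms(2) ennreal_less_top] by simp
  have sq: "integrable M (\<lambda>\<omega>. (Y \<omega>)\<^sup>2)"
    using Y fin by (intro integrableI_bounded) auto
  then show int: "integrable M Y" by (rule square_integrable_imp_integrable[OF Y])
  have "ennreal (\<integral>\<omega>. (Y \<omega>)\<^sup>2 \<partial>M) \<le> ennreal b"
    using assms(2) nn_integral_eq_integral[OF sq] by simp
  then have "(\<integral>\<omega>. (Y \<omega>)\<^sup>2 \<partial>M) \<le> b" using assms(3) by (simp add: ennreal_le_iff)
  moreover have "0 \<le> variance Y" by simp
  ultimately have "(\<integral>\<omega>. Y \<omega> \<partial>M)\<^sup>2 \<le> b"
    using variance_eq[OF int sq] by linarith
  then show "(\<integral>\<omega>. Y \<omega> \<partial>M) \<le> sqrt b" by (rule real_le_rsqrt)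
qed

subsection \<open>Step sizes and convergence rates\<close>

text \<open>Inequalities between powers with exponents in thirds are reduced below to polynomial
  ones by cubing both sides.\<close>

lemma powr_two_thirds_cube: "0 \<le> x \<Longrightarrow> (x powr (2/3)) ^ 3 = (x::real)\<^sup>2"
  using powr_power[of x "2/3" 3] by (cases "x = 0") simp_all

lemma powr_third_cube: "0 \<le> x \<Longrightarrow> (x powr (1/3)) ^ 3 = (x::real)"
  using powr_power[of x "1/3" 3] by (cases "x = 0") simp_all

lemma cube_le_imp_le:
  fixes x y :: real
  assumes "x ^ 3 \<le> y ^ 3" "0 \<le> y"
  shows "x \<le> y"
  using power_le_imp_le_base[of x 2 y] assms by (simp add: eval_nat_numeral)

text \<open>A discrete form of the derivative of \<open>t powr (2/3)\<close>, used to sum the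
  per-step errors. Multiplied by \<open>(t + 1) powr (1/3)\<close>, it reduces to the mean
  inequality \<open>?a * ?b \<le> t + 1/3\<close>.\<close>

lemma powr_two_thirds_increment:
  fixes t :: real
  assumes "0 \<le> t"
  shows "t powr (2/3) + 2 / 3 * (t + 2) powr (-1/3) \<le> (t + 1) powr (2/3)"
proof -
  let ?a = "t powr (2/3)" and ?b = "(t + 1) powr (1/3)"
  have b: "0 < ?b" using assms by simp
  have "(?a * ?b) ^ 3 = t\<^sup>2 * (t + 1)"
    using assms by (simp add: power_mult_distrib powr_two_thirds_cube powr_third_cube)
  \<comment> \<open>The added terms complete the cube of \<open>t + 1/3\<close>.\<close>
  also have "\<dots> \<le> t\<^sup>2 * (t + 1) + t / 3 + 1 / 27" using assms by simp
  also have "\<dots> = (t + 1/3) ^ 3" by (simp add: power2_eq_square power3_eq_cube field_simps)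
  finally have "?a * ?b \<le> t + 1/3" by (rule cube_le_imp_le) (use assms in auto)
  moreover have "(t + 1) powr (2/3) * ?b = t + 1" "(t + 1) powr (-1/3) * ?b = 1"
    using assms by (simp_all add: powr_add[symmetric])
  ultimately have "(?a + 2 / 3 * (t + 1) powr (-1/3)) * ?b \<le> (t + 1) powr (2/3) * ?b"
    by (simp add: algebra_simps)
  then have "?a + 2 / 3 * (t + 1) powr (-1/3) \<le> (t + 1) powr (2/3)" using b by simp
  moreover have "(t + 2) powr (-1/3) \<le> (t + 1) powr (-1/3)"
    using assms by (intro powr_mono2') auto
  ultimately show ?thesis by simp
qed

text \<open>The contraction gains \<open>16/9 * (p * q)\<close>. Of this, \<open>p * q\<close> pays
  for the noise \<open>q * q\<close>, and the remaining \<open>7/9 * (p * q)\<close> pays for the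
  decrease \<open>4/9 * (p - p')\<close> of the target; hence the constant 7 below.\<close>

lemma rate_induction_step:
  fixes t :: real
  assumes t: "0 \<le> t"
  shows "(1 - 4 / (t + 9) powr (2/3)) * (4/9 * (t + 2) powr (-2/3)) + (t + 9) powr (-4/3)
    \<le> 4/9 * (t + 3) powr (-2/3)"
proof -
  define p q p' where "p = (t + 2) powr (-2/3)" and "q = (t + 9) powr (-2/3)"
    and "p' = (t + 3) powr (-2/3)"
  have q0: "0 < q" "0 < p" using t by (auto simp: q_def p_def)
  have qp: "q \<le> p" unfolding p_def q_def using t by (intro powr_mono2') auto
  have e1: "4 / (t + 9) powr (2/3) = 4 * q" by (simp add: q_def powr_minus_divide)
  have e2: "(t + 9) powr (-4/3) = q * q" by (simp add: q_def powr_add[symmetric])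
  have "(4 * (t + 9) powr (2/3)) ^ 3 = 64 * (t + 9)\<^sup>2"
    using t by (simp add: power_mult_distrib powr_two_thirds_cube)
  also have "\<dots> \<le> (7 * (t + 3)) ^ 3"
    using t by (simp add: power2_eq_square power3_eq_cube algebra_simps)
  finally have "4 * (t + 9) powr (2/3) \<le> 7 * (t + 3)"
    by (rule cube_le_imp_le) (use t in auto)
  then have "4 / (t + 3) \<le> 7 * q"
    using t by (simp add: q_def powr_minus_divide field_simps)
  then have A: "p * (4 / (t + 3)) \<le> p * (7 * q)" using q0 by (intro mult_left_mono) auto
  \<comment> \<open>A base below 1 grows when the exponent drops from 1 to 2/3; this bounds
    \<open>p - p'\<close> by \<open>p / (t + 3)\<close>.\<close>
  have "(t + 2) / (t + 3) = ((t + 2) / (t + 3)) powr 1" using t by simp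
  also have "\<dots> \<le> ((t + 2) / (t + 3)) powr (2/3)" using t by (intro powr_mono') auto
  also have "\<dots> = p' / p"
    using t by (simp add: p_def p'_def powr_divide powr_minus_divide)
  finally have "p * ((t + 2) / (t + 3)) \<le> p'" using q0 by (simp add: field_simps)
  then have "p - p' \<le> p * (1 - (t + 2) / (t + 3))" by (simp add: algebra_simps)
  also have "1 - (t + 2) / (t + 3) = 1 / (t + 3)" using t by (simp add: field_simps)
  finally have "4 * (p - p') \<le> 4 * (p * (1 / (t + 3)))" by (rule mult_left_mono) simp
  with A have B: "4 * (p - p') \<le> 7 * (p * q)" by (simp add: mult.left_commute mult.commute)
  have "q * q \<le> p * q" using qp q0 by (intro mult_right_mono) auto
  moreover have "(1 - 4 * q) * (4/9 * p) + q * q = 4/9 * p - 16/9 * (p * q) + q * q"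
    by (simp add: field_simps)
  moreover have "4/9 * p - 16/9 * w + w' \<le> 4/9 * p'" if "w' \<le> w" "4 * (p - p') \<le> 7 * w" for w w'
    using that by simp
  ultimately have "(1 - 4 * q) * (4/9 * p) + q * q \<le> 4/9 * p'" using B by metis
  then show ?thesis by (simp only: e1 e2 p_def p'_def)
qed

text \<open>Base case of the rate: \<open>scg_Q\<close> weights the initial error by
  \<open>9 powr (2/3)\<close>, which leaves the factor on the left.\<close>

lemma rate_initial: "9 powr (-2/3) \<le> 4/9 * (2::real) powr (-2/3)"
proof -
  have "(9 * 2 powr (2/3)) ^ 3 = (9 ^ 3 * 2\<^sup>2 :: real)"
    by (simp only: power_mult_distrib) (simp add: powr_two_thirds_cube)
  also have "\<dots> \<le> 4 ^ 3 * 9\<^sup>2" by simp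
  also have "\<dots> = (4 * 9 powr (2/3)) ^ 3"
    by (simp only: power_mult_distrib) (simp add: powr_two_thirds_cube)
  finally have "9 * 2 powr (2/3) \<le> (4 * 9 powr (2/3) :: real)" by (rule cube_le_imp_le) simp
  then show ?thesis by (simp add: powr_minus_divide field_simps)
qed

text \<open>
  Young's inequality with weight \<^term>\<open>r / 2\<close>, using
  \<^term>\<open>(1 - r)\<^sup>2 * (1 + r / 2) \<le> 1 - r\<close> and \<^term>\<open>(1 - r)\<^sup>2 * (1 + 2 / r) \<le> 2 / r\<close>.
\<close>
lemma averaging_contraction:
  fixes e \<delta> :: "'a :: real_inner"
  assumes r: "0 < r" "r \<le> 1" and \<delta>: "norm \<delta> \<le> k"
  shows "(norm ((1 - r) *\<^sub>R (e + \<delta>)))\<^sup>2 \<le> (1 - r) * (norm e)\<^sup>2 + 2 / r * k\<^sup>2"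
proof -
  have k: "(norm \<delta>)\<^sup>2 \<le> k\<^sup>2" using \<delta> by (intro power_mono) auto
  have "0 \<le> 2 / r * (norm ((r / 2) *\<^sub>R e - \<delta>))\<^sup>2" using r by simp
  also have "(norm ((r / 2) *\<^sub>R e - \<delta>))\<^sup>2 = (r / 2)\<^sup>2 * (norm e)\<^sup>2 - r * (e \<bullet> \<delta>) + (norm \<delta>)\<^sup>2"
    unfolding power2_norm_eq_inner inner_diff_left inner_diff_right inner_scaleR_left inner_scaleR_right
    by (simp add: inner_commute[of \<delta> e] power2_eq_square algebra_simps)
  also have "2 / r * \<dots> = r / 2 * (norm e)\<^sup>2 - 2 * (e \<bullet> \<delta>) + 2 / r * (norm \<delta>)\<^sup>2"
    using r by (simp add: power2_eq_square distrib_left right_diff_distrib)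
  finally have "2 * (e \<bullet> \<delta>) \<le> r / 2 * (norm e)\<^sup>2 + 2 / r * (norm \<delta>)\<^sup>2" by simp
  then have "(norm (e + \<delta>))\<^sup>2 \<le> (1 + r / 2) * (norm e)\<^sup>2 + (1 + 2 / r) * (norm \<delta>)\<^sup>2"
    by (simp add: power2_norm_eq_inner inner_add_left inner_add_right inner_commute algebra_simps)
  then have "(norm ((1 - r) *\<^sub>R (e + \<delta>)))\<^sup>2
      \<le> (1 - r)\<^sup>2 * ((1 + r / 2) * (norm e)\<^sup>2 + (1 + 2 / r) * (norm \<delta>)\<^sup>2)"
    by (simp add: power_mult_distrib mult_left_mono)
  also have "\<dots> = ((1 - r)\<^sup>2 * (1 + r / 2)) * (norm e)\<^sup>2 + ((1 - r)\<^sup>2 * (1 + 2 / r)) * (norm \<delta>)\<^sup>2"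
    by (simp add: algebra_simps)
  also have "\<dots> \<le> (1 - r) * (norm e)\<^sup>2 + 2 / r * k\<^sup>2"
  proof (intro add_mono mult_mono k)
    have "(1 - r) * (1 + r / 2) \<le> 1" using r by (simp add: algebra_simps)
    then have "(1 - r) * ((1 - r) * (1 + r / 2)) \<le> (1 - r) * 1" using r by (intro mult_left_mono) auto
    then show "(1 - r)\<^sup>2 * (1 + r / 2) \<le> 1 - r" by (simp add: power2_eq_square mult.assoc)
    have "(1 - r)\<^sup>2 * (1 + 2 / r) = 2 / r - 3 + r\<^sup>2"
      using r by (simp add: field_simps power2_eq_square)
    also have "r\<^sup>2 \<le> 1" using r by (simp add: power_le_one)
    finally show "(1 - r)\<^sup>2 * (1 + 2 / r) \<le> 2 / r" by simp
  qed (use r in auto)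
  finally show ?thesis .
qed

subsection \<open>Analysis of the algorithm\<close>

lemma scg_Q_nonneg: "0 \<le> scg_Q gF L D \<sigma>"
  by (simp add: scg_Q_def le_max_iff_disj)

text \<open>The step sizes \<open>\<rho>\<close> stay free here and are fixed only for the rates.
  The maps \<open>\<kappa> t\<close> encode that ties are resolved by the first \<open>t\<close>
  samples alone; in particular \<open>v 0\<close> is constant.\<close>

locale scg_process = prob_space M for M :: "'w measure" +
  fixes u :: "real^'n"
    and X C :: "(real^'n) set"
    and F :: "real^'n \<Rightarrow> real" and gF :: "real^'n \<Rightarrow> real^'n"
    and gFt :: "real^'n \<Rightarrow> 'z \<Rightarrow> real^'n"
    and P :: "'z measure"
    and L D \<sigma> :: real and T :: nat
    and z :: "nat \<Rightarrow> 'w \<Rightarrow> 'z"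
    and \<kappa> :: "nat \<Rightarrow> (nat \<Rightarrow> 'z) \<Rightarrow> real^'n"
    and d v x :: "nat \<Rightarrow> 'w \<Rightarrow> real^'n"
    and \<rho> :: "nat \<Rightarrow> real"
  assumes box: "0 \<le> u" "X = cbox 0 u"
    and C: "C \<subseteq> X" "C \<noteq> {}"
    and D: "\<And>y. y \<in> C \<Longrightarrow> norm y \<le> D"
    and F_mono: "mono_on X F"
    and F_DR: "DR_submodular_on X F gF"
    and F_smooth: "L-lipschitz_on X gF"
    and P: "prob_space P"
    and gFt_measurable:
      "(\<lambda>(y, \<zeta>). gFt y \<zeta>) \<in> borel_measurable (restrict_space borel X \<Otimes>\<^sub>M P)"
    and unbiased: "\<And>y. y \<in> X \<Longrightarrow> has_bochner_integral P (gFt y) (gF y)"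
    and variance_integrable:
      "\<And>y. y \<in> X \<Longrightarrow> integrable P (\<lambda>\<zeta>. (norm (gFt y \<zeta> - gF y))\<^sup>2)"
    and variance_bound:
      "\<And>y. y \<in> X \<Longrightarrow> (\<integral>\<zeta>. (norm (gFt y \<zeta> - gF y))\<^sup>2 \<partial>P) \<le> \<sigma>\<^sup>2"
    and z_indep: "indep_vars (\<lambda>_. P) z {1..}"
    and z_law: "\<And>t. 1 \<le> t \<Longrightarrow> distr M P (z t) = P"
    and T: "1 \<le> T"
    and ties_measurable: "\<And>t. t < T \<Longrightarrow> \<kappa> t \<in> borel_measurable (PiM {1..t} (\<lambda>_. P))"
    and ties_past: "\<And>t \<omega>. t < T \<Longrightarrow> \<omega> \<in> space M \<Longrightarrow> v t \<omega> = \<kappa> t (\<lambda>s\<in>{1..t}. z s \<omega>)"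
    and scg: "\<And>\<omega>. \<omega> \<in> space M \<Longrightarrow>
      scg_run gFt C T \<rho> (\<lambda>t. z t \<omega>) (\<lambda>t. d t \<omega>) (\<lambda>t. v t \<omega>) (\<lambda>t. x t \<omega>)"
begin

section \<open>Pathwise properties of a run\<close>

lemma run:
  assumes "\<omega> \<in> space M"
  shows "d 0 \<omega> = 0" "x 0 \<omega> = 0"
    and "t < T \<Longrightarrow> d (Suc t) \<omega> = (1 - \<rho> (Suc t)) *\<^sub>R d t \<omega> + \<rho> (Suc t) *\<^sub>R gFt (x (Suc t) \<omega>) (z (Suc t) \<omega>)"
    and "t < T \<Longrightarrow> is_arg_max (\<lambda>w. d t \<omega> \<bullet> w) (\<lambda>w. w \<in> C) (v t \<omega>)"
    and "t < T \<Longrightarrow> x (Suc t) \<omega> = x t \<omega> + (1 / real T) *\<^sub>R v t \<omega>"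
proof -
  note r = scg[OF assms, unfolded scg_run_def]
  from r show "d 0 \<omega> = 0" "x 0 \<omega> = 0" by blast+
  from r have "\<forall>t\<in>{1..T}. d t \<omega> = (1 - \<rho> t) *\<^sub>R d (t - 1) \<omega> + \<rho> t *\<^sub>R gFt (x t \<omega>) (z t \<omega>)"
    by blast
  from bspec[OF this, of "Suc t"]
  show "t < T \<Longrightarrow> d (Suc t) \<omega> = (1 - \<rho> (Suc t)) *\<^sub>R d t \<omega> + \<rho> (Suc t) *\<^sub>R gFt (x (Suc t) \<omega>) (z (Suc t) \<omega>)"
    by simp
  from r show "t < T \<Longrightarrow> is_arg_max (\<lambda>w. d t \<omega> \<bullet> w) (\<lambda>w. w \<in> C) (v t \<omega>)" by blast
  from r have "\<forall>t<T. x (t + 1) \<omega> = x t \<omega> + (1 / real T) *\<^sub>R v t \<omega>" by blast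
  then show "t < T \<Longrightarrow> x (Suc t) \<omega> = x t \<omega> + (1 / real T) *\<^sub>R v t \<omega>" by simp
qed

lemma v_in_C: "t < T \<Longrightarrow> \<omega> \<in> space M \<Longrightarrow> v t \<omega> \<in> C"
  using run(4) by (auto simp: is_arg_max_def)

lemma grad: "gradient_on X F gF"
  using F_DR by (simp add: DR_submodular_on_def)

lemma D_nonneg: "0 \<le> D"
  using C(2) D norm_ge_zero order_trans by blast

lemma zero_in_X: "0 \<in> X"
  using box by (simp add: cbox_interval)

text \<open>Before the last round the iterate is a sum of fewer than \<open>T\<close> points of
  \<open>C\<close>, each scaled by \<open>1 / real T\<close>, and may lie outside \<open>C\<close>.
  The induction therefore tracks the box scaled by \<open>real t / real T\<close>.\<close>

lemma x_in_X:
  assumes "t \<le> T" "\<omega> \<in> space M"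
  shows "x t \<omega> \<in> X"
proof -
  have "0 \<le> x t \<omega> \<and> x t \<omega> \<le> (real t / real T) *\<^sub>R u"
    using assms(1)
  proof (induction t)
    case 0
    then show ?case using run(2)[OF assms(2)] by simp
  next
    case (Suc t)
    have "v t \<omega> \<in> X" using v_in_C[of t \<omega>] Suc assms C by auto
    then have v: "0 \<le> v t \<omega>" "v t \<omega> \<le> u" by (auto simp: box cbox_interval)
    have "0 \<le> (1 / real T) *\<^sub>R v t \<omega>" "(1 / real T) *\<^sub>R v t \<omega> \<le> (1 / real T) *\<^sub>R u"
      using v by (auto intro!: scaleR_nonneg_nonneg scaleR_left_mono)
    moreover have "(real (Suc t) / real T) *\<^sub>R u = (real t / real T) *\<^sub>R u + (1 / real T) *\<^sub>R u"
      by (simp add: scaleR_left_distrib[symmetric] add_divide_distrib)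
    ultimately show ?case using Suc run(5)[OF assms(2), of t] by (auto intro: add_mono)
  qed
  moreover have "(real t / real T) *\<^sub>R u \<le> 1 *\<^sub>R u"
    using assms(1) T box by (intro scaleR_right_mono) auto
  ultimately show ?thesis by (metis atLeastAtMost_iff box(2) cbox_interval order_trans scaleR_one)
qed

section \<open>Adaptedness of the iterates to the samples\<close>

text \<open>The sigma-algebra generated by samples 1 to \<open>t\<close>, placed on
  \<open>space M\<close>; \<open>past 0\<close> is trivial.\<close>

definition past :: "nat \<Rightarrow> 'w measure" where
  "past t = vimage_algebra (space M) (\<lambda>\<omega>. \<lambda>s\<in>{1..t}. z s \<omega>) (PiM {1..t} (\<lambda>_. P))"

lemma space_past [simp]: "space (past t) = space M"
  by (simp add: past_def)

lemma z_measurable: "1 \<le> s \<Longrightarrow> z s \<in> measurable M P"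
  using z_indep by (auto simp: indep_vars_def)

lemma samples_in_space: "(\<lambda>\<omega>. \<lambda>s\<in>{1..t}. z s \<omega>) \<in> space M \<rightarrow> space (PiM {1..t} (\<lambda>_. P))"
  using measurable_space[OF z_measurable] by (auto simp: space_PiM)

lemma samples_past: "(\<lambda>\<omega>. \<lambda>s\<in>{1..t}. z s \<omega>) \<in> measurable (past t) (PiM {1..t} (\<lambda>_. P))"
  unfolding past_def by (rule measurable_vimage_algebra1[OF samples_in_space])

lemma z_past: "1 \<le> s \<Longrightarrow> s \<le> t \<Longrightarrow> z s \<in> measurable (past t) P"
  using measurable_compose[OF samples_past[of t] measurable_component_singleton[of s "{1..t}"]] by simp

lemma past_mono:
  assumes f: "f \<in> measurable (past s) N" and "s \<le> t"
  shows "f \<in> measurable (past t) N"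
proof -
  have "(\<lambda>\<omega>. \<omega>) \<in> measurable (past t) (past s)"
    unfolding past_def[of s]
    by (rule measurable_vimage_algebra2) (use assms(2) in \<open>auto intro!: measurable_restrict z_past\<close>)
  from measurable_compose[OF this f] show ?thesis .
qed

lemma past_imp_measurable:
  assumes f: "f \<in> measurable (past t) N"
  shows "f \<in> measurable M N"
proof -
  have "(\<lambda>\<omega>. \<omega>) \<in> measurable M (past t)"
    unfolding past_def
    by (rule measurable_vimage_algebra2) (auto intro!: measurable_restrict z_measurable)
  from measurable_compose[OF this f] show ?thesis .
qed

lemma v_past:
  assumes "t < T"
  shows "v t \<in> borel_measurable (past t)"
  using measurable_compose[OF samples_past ties_measurable[OF assms]]
  by (rule measurable_cong[THEN iffD1, rotated]) (simp add: ties_past assms)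

text \<open>One index earlier than \<open>d_past\<close>: \<open>x t\<close> is fixed before sample
  \<open>t\<close> is drawn, so that sample is fresh when the gradient is evaluated there. For
  \<open>t = 0\<close> the truncated difference gives \<open>past 0\<close>.\<close>

lemma x_past: "t \<le> T \<Longrightarrow> x t \<in> borel_measurable (past (t - 1))"
proof (induction t)
  case 0
  show ?case using measurable_cong[of "past 0" "x 0" "\<lambda>_. 0" borel] by (simp add: run)
next
  case (Suc t)
  have "x t \<in> borel_measurable (past t)" using Suc by (intro past_mono[OF Suc.IH]) auto
  then have "(\<lambda>\<omega>. x t \<omega> + (1 / real T) *\<^sub>R v t \<omega>) \<in> borel_measurable (past t)"
    using v_past[of t] Suc.prems by auto
  then have "x (Suc t) \<in> borel_measurable (past t)"
    by (rule measurable_cong[THEN iffD2, rotated]) (use Suc.prems in \<open>simp add: run\<close>)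
  then show ?case by simp
qed

lemma x_past_X:
  assumes "t \<le> T"
  shows "x t \<in> measurable (past (t - 1)) (restrict_space borel X)"
proof (rule measurable_restrict_space2)
  show "x t \<in> space (past (t - 1)) \<rightarrow> X" using x_in_X[OF assms] by simp
qed (rule x_past[OF assms])

lemma gF_measurable: "gF \<in> borel_measurable (restrict_space borel X)"
  by (rule borel_measurable_continuous_on_restrict) (rule lipschitz_on_continuous_on[OF F_smooth])

lemma gFt_x_measurable:
  assumes "t < T"
  shows "(\<lambda>(\<omega>, \<zeta>). gFt (x (Suc t) \<omega>) \<zeta>) \<in> borel_measurable (past t \<Otimes>\<^sub>M P)"
proof -
  have "x (Suc t) \<in> measurable (past t) (restrict_space borel X)"
    using x_past_X[of "Suc t"] assms by simp
  then have "(\<lambda>p. (x (Suc t) (fst p), snd p)) \<in> measurable (past t \<Otimes>\<^sub>M P) (restrict_space borel X \<Otimes>\<^sub>M P)"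
    by (intro measurable_Pair measurable_compose[OF measurable_fst] measurable_snd)
  from measurable_compose[OF this gFt_measurable] show ?thesis by (simp add: case_prod_beta')
qed

lemma d_past: "t \<le> T \<Longrightarrow> d t \<in> borel_measurable (past t)"
proof (induction t)
  case 0
  show ?case using measurable_cong[of "past 0" "d 0" "\<lambda>_. 0" borel] by (simp add: run)
next
  case (Suc t)
  have "x (Suc t) \<in> measurable (past (Suc t)) (restrict_space borel X)"
    using past_mono[OF x_past_X[OF Suc.prems], of "Suc t"] by simp
  then have "(\<lambda>\<omega>. (x (Suc t) \<omega>, z (Suc t) \<omega>)) \<in> measurable (past (Suc t)) (restrict_space borel X \<Otimes>\<^sub>M P)"
    by (intro measurable_Pair z_past) auto
  from measurable_compose[OF this gFt_measurable]
  have "(\<lambda>\<omega>. gFt (x (Suc t) \<omega>) (z (Suc t) \<omega>)) \<in> borel_measurable (past (Suc t))" by simp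
  moreover have "d t \<in> borel_measurable (past (Suc t))"
    using Suc by (intro past_mono[OF Suc.IH]) auto
  ultimately have "(\<lambda>\<omega>. (1 - \<rho> (Suc t)) *\<^sub>R d t \<omega> + \<rho> (Suc t) *\<^sub>R gFt (x (Suc t) \<omega>) (z (Suc t) \<omega>))
      \<in> borel_measurable (past (Suc t))"
    by (intro borel_measurable_add borel_measurable_scaleR borel_measurable_const)
  then show ?case
    by (rule measurable_cong[THEN iffD2, rotated]) (use Suc.prems in \<open>simp add: run\<close>)
qed

section \<open>Mean-square error of the averaged gradient\<close>

definition err :: "nat \<Rightarrow> 'w \<Rightarrow> real^'n" where
  "err t \<omega> = gF (x t \<omega>) - d t \<omega>"

lemma gF_x_past: "t \<le> T \<Longrightarrow> (\<lambda>\<omega>. gF (x t \<omega>)) \<in> borel_measurable (past (t - 1))"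
  by (rule measurable_compose[OF x_past_X gF_measurable])

lemma err_past:
  assumes "t \<le> T"
  shows "err t \<in> borel_measurable (past t)"
proof -
  have "(\<lambda>\<omega>. gF (x t \<omega>)) \<in> borel_measurable (past t)"
    by (rule past_mono[OF gF_x_past[OF assms]]) simp
  then show ?thesis
    unfolding err_def[abs_def] using d_past[OF assms] by (rule borel_measurable_diff)
qed

lemma gradient_drift:
  assumes "t < T" "\<omega> \<in> space M"
  shows "norm (gF (x (Suc t) \<omega>) - gF (x t \<omega>)) \<le> L * D / real T"
proof -
  have "norm (gF (x (Suc t) \<omega>) - gF (x t \<omega>)) \<le> L * norm (x (Suc t) \<omega> - x t \<omega>)"
    using lipschitz_onD[OF F_smooth x_in_X x_in_X, of "Suc t" \<omega> t \<omega>] assms by (simp add: dist_norm)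
  also have "norm (x (Suc t) \<omega> - x t \<omega>) = norm (v t \<omega>) / real T"
    using assms by (simp add: run)
  also have "L * \<dots> \<le> L * (D / real T)"
    using lipschitz_on_nonneg[OF F_smooth] D[OF v_in_C[OF assms]]
    by (intro mult_left_mono divide_right_mono) auto
  finally show ?thesis by simp
qed

lemma mean_square_step:
  assumes t: "t < T" and r: "0 < \<rho> (Suc t)" "\<rho> (Suc t) \<le> 1" and b: "0 \<le> b"
    and IH: "(\<integral>\<^sup>+\<omega>. ennreal ((norm (err t \<omega>))\<^sup>2) \<partial>M) \<le> ennreal b"
  shows "(\<integral>\<^sup>+\<omega>. ennreal ((norm (err (Suc t) \<omega>))\<^sup>2) \<partial>M) \<le>
    ennreal ((1 - \<rho> (Suc t)) * b + 2 / \<rho> (Suc t) * (L * D / real T)\<^sup>2 + (\<rho> (Suc t))\<^sup>2 * \<sigma>\<^sup>2)"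
proof -
  interpret P: prob_space P by (rule P)
  define r where "r = \<rho> (Suc t)"
  define k where "k = 2 / r * (L * D / real T)\<^sup>2 + r\<^sup>2 * \<sigma>\<^sup>2"
  define y where "y = x (Suc t)"
  \<comment> \<open>The new error is \<open>A\<close> plus \<open>r\<close> times the centred noise
    of sample \<open>Suc t\<close>. Both \<open>A\<close> and \<open>y\<close> are determined by the
    first \<open>t\<close> samples, so \<open>nn_integral_past\<close> allows averaging over the
    fresh sample with them frozen.\<close>
  define A where "A \<omega> = (1 - r) *\<^sub>R (err t \<omega> + (gF (y \<omega>) - gF (x t \<omega>)))" for \<omega>
  define h where "h = (\<lambda>(\<omega>, \<zeta>). ennreal ((norm (A \<omega> + r *\<^sub>R (gF (y \<omega>) - gFt (y \<omega>) \<zeta>)))\<^sup>2))"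
  have r01: "0 < r" "r \<le> 1" using r by (auto simp: r_def)
  have k: "0 \<le> k" using r01 by (simp add: k_def)
  have yX: "y \<omega> \<in> X" if "\<omega> \<in> space M" for \<omega> using t that by (simp add: y_def x_in_X)
  have gy: "(\<lambda>\<omega>. gF (y \<omega>)) \<in> borel_measurable (past t)"
    using gF_x_past[of "Suc t"] t by (simp add: y_def)
  have "(\<lambda>\<omega>. gF (x t \<omega>)) \<in> borel_measurable (past t)"
    by (rule past_mono[OF gF_x_past]) (use t in auto)
  then have Am: "A \<in> borel_measurable (past t)"
    unfolding A_def[abs_def] using gy err_past[of t] t by auto
  have "(\<lambda>p. A (fst p) + r *\<^sub>R (gF (y (fst p)) - gFt (y (fst p)) (snd p))) \<in> borel_measurable (past t \<Otimes>\<^sub>M P)"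
    using gFt_x_measurable[OF t] measurable_compose[OF measurable_fst Am]
      measurable_compose[OF measurable_fst gy]
    by (auto simp: y_def case_prod_beta' intro!: borel_measurable_add borel_measurable_scaleR borel_measurable_diff)
  then have hm: "h \<in> borel_measurable (past t \<Otimes>\<^sub>M P)"
    unfolding h_def case_prod_beta' by measurable
  have "err (Suc t) \<omega> = A \<omega> + r *\<^sub>R (gF (y \<omega>) - gFt (y \<omega>) (z (Suc t) \<omega>))" if "\<omega> \<in> space M" for \<omega>
    using run(3)[OF that t] by (simp add: err_def A_def y_def r_def algebra_simps)
  then have "(\<integral>\<^sup>+\<omega>. ennreal ((norm (err (Suc t) \<omega>))\<^sup>2) \<partial>M) = (\<integral>\<^sup>+\<omega>. h (\<omega>, z (Suc t) \<omega>) \<partial>M)"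
    by (intro nn_integral_cong) (simp add: h_def)
  also have "\<dots> = (\<integral>\<^sup>+\<omega>. (\<integral>\<^sup>+\<zeta>. h (\<omega>, \<zeta>) \<partial>P) \<partial>M)"
    using nn_integral_past[OF z_indep, of "{1..t}" "Suc t" h] hm z_law by (simp add: past_def)
  also have "\<dots> \<le> (\<integral>\<^sup>+\<omega>. ennreal ((1 - r) * (norm (err t \<omega>))\<^sup>2 + k) \<partial>M)"
  proof (rule nn_integral_mono)
    fix \<omega> assume \<omega>: "\<omega> \<in> space M"
    have "(\<integral>\<^sup>+\<zeta>. h (\<omega>, \<zeta>) \<partial>P) \<le> ennreal ((norm (A \<omega>))\<^sup>2 + r\<^sup>2 * \<sigma>\<^sup>2)"
      unfolding h_def prod.case
      by (rule P.nn_integral_norm_add_noise_le[OF unbiased variance_integrable variance_bound])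
        (rule yX[OF \<omega>])+
    also have "(norm (A \<omega>))\<^sup>2 \<le> (1 - r) * (norm (err t \<omega>))\<^sup>2 + 2 / r * (L * D / real T)\<^sup>2"
      unfolding A_def y_def by (rule averaging_contraction[OF r01 gradient_drift[OF t \<omega>]])
    then have "ennreal ((norm (A \<omega>))\<^sup>2 + r\<^sup>2 * \<sigma>\<^sup>2) \<le> ennreal ((1 - r) * (norm (err t \<omega>))\<^sup>2 + k)"
      by (intro ennreal_leI) (simp add: k_def)
    finally show "(\<integral>\<^sup>+\<zeta>. h (\<omega>, \<zeta>) \<partial>P) \<le> ennreal ((1 - r) * (norm (err t \<omega>))\<^sup>2 + k)" .
  qed
  also have "\<dots> = ennreal (1 - r) * (\<integral>\<^sup>+\<omega>. ennreal ((norm (err t \<omega>))\<^sup>2) \<partial>M) + ennreal k"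
    using past_imp_measurable[OF err_past[of t]] t r01 k
    by (simp add: ennreal_plus ennreal_mult nn_integral_add nn_integral_cmult emeasure_space_1)
  also have "\<dots> \<le> ennreal (1 - r) * ennreal b + ennreal k"
    by (intro add_right_mono mult_left_mono IH) simp
  also have "\<dots> = ennreal ((1 - r) * b + k)"
    using r01 b k by (simp add: ennreal_plus ennreal_mult)
  finally show ?thesis by (simp add: k_def r_def add.assoc)
qed

section \<open>Expected gap to a comparison point\<close>

lemma F_x_integrable:
  assumes "t \<le> T"
  shows "integrable M (\<lambda>\<omega>. F (x t \<omega>))"
proof -
  have "continuous_on X F"
    unfolding continuous_on_eq_continuous_within
    using grad by (auto simp: gradient_on_def intro: has_derivative_continuous)
  then have "F \<in> borel_measurable (restrict_space borel X)"
    by (rule borel_measurable_continuous_on_restrict)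
  then have m: "(\<lambda>\<omega>. F (x t \<omega>)) \<in> borel_measurable M"
    by (rule past_imp_measurable[OF measurable_compose[OF x_past_X[OF assms]]])
  \<comment> \<open>Monotonicity bounds \<open>F\<close> by its values at the two extreme corners of
    the box.\<close>
  have "F 0 \<le> F y \<and> F y \<le> F u" if "y \<in> X" for y
    using that box zero_in_X by (auto intro!: mono_onD[OF F_mono] simp: cbox_interval)
  then have "F 0 \<le> F (x t \<omega>) \<and> F (x t \<omega>) \<le> F u" if "\<omega> \<in> space M" for \<omega>
    using x_in_X[OF assms that] by blast
  then have "\<bar>F (x t \<omega>)\<bar> \<le> max \<bar>F 0\<bar> \<bar>F u\<bar>" if "\<omega> \<in> space M" for \<omega>
    using that by fastforce
  then show ?thesis using m
    by (intro integrable_const_bound[where B="max \<bar>F 0\<bar> \<bar>F u\<bar>"]) auto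
qed

lemma expected_gap_step:
  assumes t: "t < T" and y: "y \<in> C"
    and MS: "(\<integral>\<^sup>+\<omega>. ennreal ((norm (err t \<omega>))\<^sup>2) \<partial>M) \<le> ennreal b" "0 \<le> b"
  shows "F y - expectation (\<lambda>\<omega>. F (x (Suc t) \<omega>)) \<le>
    (1 - 1 / real T) * (F y - expectation (\<lambda>\<omega>. F (x t \<omega>)))
    + 2 * D / real T * sqrt b + L * D\<^sup>2 / (2 * (real T)\<^sup>2)"
proof -
  have e: "integrable M (\<lambda>\<omega>. norm (err t \<omega>))" "expectation (\<lambda>\<omega>. norm (err t \<omega>)) \<le> sqrt b"
    using expectation_le_sqrt[OF _ MS] past_imp_measurable[OF err_past[of t]] t by auto
  have int: "integrable M (\<lambda>\<omega>. F (x t \<omega>))" "integrable M (\<lambda>\<omega>. F (x (Suc t) \<omega>))"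
    using F_x_integrable t by auto
  have "F y - F (x (Suc t) \<omega>) \<le> (1 - 1 / real T) * (F y - F (x t \<omega>))
      + 2 * D / real T * norm (err t \<omega>) + L * D\<^sup>2 / (2 * (real T)\<^sup>2)" if \<omega>: "\<omega> \<in> space M" for \<omega>
    using greedy_step[OF box(2) F_DR F_smooth F_mono C(1) D run(4)[OF \<omega> t] _ _ y,
        where x = "x t \<omega>" and h = "1 / real T"]
      x_in_X[OF _ \<omega>, of t] x_in_X[OF _ \<omega>, of "Suc t"] t \<omega>
    by (simp add: run err_def power_divide mult.commute)
  then have "expectation (\<lambda>\<omega>. F y - F (x (Suc t) \<omega>)) \<le> expectation (\<lambda>\<omega>. (1 - 1 / real T) * (F y - F (x t \<omega>))
      + 2 * D / real T * norm (err t \<omega>) + L * D\<^sup>2 / (2 * (real T)\<^sup>2))"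
    using int e by (intro integral_mono) auto
  also have "\<dots> = (1 - 1 / real T) * (F y - expectation (\<lambda>\<omega>. F (x t \<omega>)))
      + 2 * D / real T * expectation (\<lambda>\<omega>. norm (err t \<omega>)) + L * D\<^sup>2 / (2 * (real T)\<^sup>2)"
    using int e by (simp add: prob_space)
  also have "\<dots> \<le> (1 - 1 / real T) * (F y - expectation (\<lambda>\<omega>. F (x t \<omega>)))
      + 2 * D / real T * sqrt b + L * D\<^sup>2 / (2 * (real T)\<^sup>2)"
    using e(2) D_nonneg by (intro add_mono mult_left_mono order_refl) auto
  finally show ?thesis using int by (simp add: prob_space)
qed

text \<open>
  The factor 4/9 is what makes the summed error fit under the stated constant: with it,
  lemma \<open>powr_two_thirds_increment\<close> telescopes. The drift term is absorbed by the \<open>3 L\<^sup>2 D\<^sup>2\<close> in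
  \<^term>\<open>scg_Q gF L D \<sigma>\<close> because \<open>t + 9 \<le> 2 T\<close>, which is where \<open>8 \<le> T\<close> is needed.
\<close>
lemma mean_square_rate:
  assumes \<rho>: "\<rho> = (\<lambda>t. 4 / (real t + 8) powr (2/3))" and T8: "8 \<le> T" and "t \<le> T"
  shows "(\<integral>\<^sup>+\<omega>. ennreal ((norm (err t \<omega>))\<^sup>2) \<partial>M) \<le>
    ennreal (4/9 * (real t + 2) powr (-2/3) * scg_Q gF L D \<sigma>)"
  using \<open>t \<le> T\<close>
proof (induction t)
  case 0
  let ?Q = "scg_Q gF L D \<sigma>"
  have "(\<integral>\<^sup>+\<omega>. ennreal ((norm (err 0 \<omega>))\<^sup>2) \<partial>M) = (\<integral>\<^sup>+\<omega>. ennreal ((norm (gF 0))\<^sup>2) \<partial>M)"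
    by (intro nn_integral_cong) (simp add: err_def run)
  also have "\<dots> = ennreal ((norm (gF 0))\<^sup>2)" by (simp add: emeasure_space_1)
  also have "\<dots> \<le> ennreal (9 powr (-2/3) * ?Q)"
  proof (rule ennreal_leI)
    have eq: "9 powr (-2/3) * 9 powr (2/3) = (1 :: real)" by (simp flip: powr_add)
    have "(norm (gF 0))\<^sup>2 = 9 powr (-2/3) * (9 powr (2/3) * (norm (gF 0))\<^sup>2)"
      unfolding mult.assoc[symmetric] eq by simp
    also have "\<dots> \<le> 9 powr (-2/3) * ?Q"
      by (intro mult_left_mono) (auto simp: scg_Q_def)
    finally show "(norm (gF 0))\<^sup>2 \<le> 9 powr (-2/3) * ?Q" .
  qed
  also have "\<dots> \<le> ennreal (4/9 * (real 0 + 2) powr (-2/3) * ?Q)"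
    using rate_initial by (intro ennreal_leI mult_right_mono) (auto simp: scg_Q_nonneg)
  finally show ?case .
next
  case (Suc t)
  define Q w where "Q = scg_Q gF L D \<sigma>" and "w = real t + 9"
  define b where "b = 4/9 * (real t + 2) powr (-2/3) * Q"
  have Q: "0 \<le> Q" "16 * \<sigma>\<^sup>2 + 3 * (L * D)\<^sup>2 \<le> Q"
    by (auto simp: Q_def scg_Q_nonneg) (simp add: scg_Q_def power_mult_distrib)
  have w: "0 < w" by (simp add: w_def)
  have r: "\<rho> (Suc t) = 4 / w powr (2/3)" by (simp add: \<rho> w_def add.commute)
  \<comment> \<open>The offset 8 in the step size gives \<open>w \<ge> 9\<close>, and 64 is at most
    81, so the averaging weight never exceeds 1.\<close>
  have "4 ^ 3 \<le> w\<^sup>2" using power_mono[of 9 w 2] by (simp add: w_def)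
  also have "\<dots> = (w powr (2/3)) ^ 3" using w by (simp add: powr_two_thirds_cube)
  finally have "4 \<le> w powr (2/3)" by (rule cube_le_imp_le) simp
  then have r01: "0 < \<rho> (Suc t)" "\<rho> (Suc t) \<le> 1" using w by (auto simp: r)
  have "(\<rho> (Suc t))\<^sup>2 = 16 * w powr (-4/3)"
    using w by (simp add: r power2_eq_square powr_minus_divide powr_add[symmetric])
  then have noise: "(\<rho> (Suc t))\<^sup>2 * \<sigma>\<^sup>2 = 16 * \<sigma>\<^sup>2 * w powr (-4/3)" by simp
  \<comment> \<open>Brings the drift to the same power \<open>w powr (-4/3)\<close> as the noise;
    the spare \<open>w\<^sup>2\<close> is then absorbed by the square of \<open>real T\<close> in
    the drift.\<close>
  have "w powr (2/3) = w powr (2 + (-4/3))" by simp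
  also have "\<dots> = w\<^sup>2 * w powr (-4/3)"
    using w by (subst powr_add) simp
  finally have "2 / \<rho> (Suc t) = w\<^sup>2 / 2 * w powr (-4/3)" by (simp add: r)
  moreover have "w \<le> 2 * real T" using Suc.prems T8 by (simp add: w_def)
  then have "w\<^sup>2 \<le> 4 * (real T)\<^sup>2" using power_mono[of w "2 * real T" 2] w by (simp add: power_mult_distrib)
  then have "w\<^sup>2 / 2 \<le> 3 * (real T)\<^sup>2" using zero_le_power2[of "real T"] by linarith
  ultimately have "2 / \<rho> (Suc t) \<le> 3 * (real T)\<^sup>2 * w powr (-4/3)"
    by (metis mult_right_mono powr_ge_zero)
  then have "2 / \<rho> (Suc t) * (L * D / real T)\<^sup>2 \<le> 3 * (real T)\<^sup>2 * w powr (-4/3) * (L * D / real T)\<^sup>2"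
    by (rule mult_right_mono) simp
  also have "\<dots> = 3 * (L * D)\<^sup>2 * w powr (-4/3)" using T by (simp add: power_divide)
  finally have "2 / \<rho> (Suc t) * (L * D / real T)\<^sup>2 + (\<rho> (Suc t))\<^sup>2 * \<sigma>\<^sup>2
      \<le> (16 * \<sigma>\<^sup>2 + 3 * (L * D)\<^sup>2) * w powr (-4/3)"
    unfolding noise by (simp add: distrib_right)
  also have "\<dots> \<le> Q * w powr (-4/3)" using Q(2) by (rule mult_right_mono) simp
  finally have "(1 - \<rho> (Suc t)) * b + 2 / \<rho> (Suc t) * (L * D / real T)\<^sup>2 + (\<rho> (Suc t))\<^sup>2 * \<sigma>\<^sup>2
      \<le> ((1 - 4 / w powr (2/3)) * (4/9 * (real t + 2) powr (-2/3)) + w powr (-4/3)) * Q"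
    by (simp add: b_def r algebra_simps)
  also have "\<dots> \<le> (4/9 * (real t + 3) powr (-2/3)) * Q"
    using rate_induction_step[of "real t"] Q(1) by (intro mult_right_mono) (auto simp: w_def)
  finally have le: "(1 - \<rho> (Suc t)) * b + 2 / \<rho> (Suc t) * (L * D / real T)\<^sup>2 + (\<rho> (Suc t))\<^sup>2 * \<sigma>\<^sup>2
      \<le> 4/9 * (real (Suc t) + 2) powr (-2/3) * Q" by (simp add: add.commute)
  have "(\<integral>\<^sup>+\<omega>. ennreal ((norm (err (Suc t) \<omega>))\<^sup>2) \<partial>M) \<le>
      ennreal ((1 - \<rho> (Suc t)) * b + 2 / \<rho> (Suc t) * (L * D / real T)\<^sup>2 + (\<rho> (Suc t))\<^sup>2 * \<sigma>\<^sup>2)"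
    using Suc Q(1) by (intro mean_square_step r01) (auto simp: b_def Q_def)
  also have "\<dots> \<le> ennreal (4/9 * (real (Suc t) + 2) powr (-2/3) * Q)" by (rule ennreal_leI[OF le])
  finally show ?case by (simp only: Q_def)
qed

lemma expected_gap:
  assumes \<rho>: "\<rho> = (\<lambda>t. 4 / (real t + 8) powr (2/3))" and T8: "8 \<le> T" and "t \<le> T"
    and y: "y \<in> C" and F0: "0 \<le> F 0"
  shows "F y - expectation (\<lambda>\<omega>. F (x t \<omega>)) \<le> (1 - 1 / real T) ^ t * F y
    + 2 * D * sqrt (scg_Q gF L D \<sigma>) / real T * real t powr (2/3) + real t * (L * D\<^sup>2 / (2 * (real T)\<^sup>2))"
  using \<open>t \<le> T\<close>
proof (induction t)
  case 0
  have "expectation (\<lambda>\<omega>. F (x 0 \<omega>)) = expectation (\<lambda>\<omega>. F 0)"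
    by (rule Bochner_Integration.integral_cong) (auto simp: run)
  then show ?case using F0 by (simp add: prob_space)
next
  case (Suc t)
  define Q where "Q = scg_Q gF L D \<sigma>"
  define a where "a = 2 * D * sqrt Q / real T"
  define c where "c = L * D\<^sup>2 / (2 * (real T)\<^sup>2)"
  define q where "q = 1 - 1 / real T"
  define b where "b = 4/9 * (real t + 2) powr (-2/3) * Q"
  have Q: "0 \<le> Q" by (simp add: Q_def scg_Q_nonneg)
  have q: "0 \<le> q" "q \<le> 1" using T by (auto simp: q_def)
  have a: "0 \<le> a" using D_nonneg Q by (simp add: a_def)
  have c: "0 \<le> c" using lipschitz_on_nonneg[OF F_smooth] by (simp add: c_def)
  \<comment> \<open>The square root of 4/9 produces exactly the factor 2/3 of
    \<open>powr_two_thirds_increment\<close>.\<close>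
  have sqrt_b: "sqrt b = 2/3 * (real t + 2) powr (-1/3) * sqrt Q"
    by (simp add: b_def real_sqrt_mult real_sqrt_divide powr_half_sqrt[symmetric] powr_powr del: powr_half_sqrt_powr)
  have sb: "2 * D / real T * sqrt b = a * (2/3 * (real t + 2) powr (-1/3))"
    unfolding a_def sqrt_b by simp
  have "F y - expectation (\<lambda>\<omega>. F (x (Suc t) \<omega>))
      \<le> q * (F y - expectation (\<lambda>\<omega>. F (x t \<omega>))) + 2 * D / real T * sqrt b + c"
    unfolding q_def c_def
    using mean_square_rate[OF \<rho> T8, of t] Suc.prems Q y
    by (intro expected_gap_step) (auto simp: b_def Q_def)
  also have "q * (F y - expectation (\<lambda>\<omega>. F (x t \<omega>))) \<le> q * (q ^ t * F y + a * real t powr (2/3) + real t * c)"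
    using Suc q by (intro mult_left_mono) (auto simp: q_def a_def c_def Q_def)
  \<comment> \<open>The factor \<open>q\<close> is bounded by 1 on the error terms only; on
    \<open>F y\<close> it must accumulate to yield the constant
    \<open>1 - 1 / exp 1\<close>.\<close>
  also have "q * (q ^ t * F y + a * real t powr (2/3) + real t * c)
      \<le> q ^ Suc t * F y + a * real t powr (2/3) + real t * c"
  proof -
    have "q * (a * real t powr (2/3) + real t * c) \<le> 1 * (a * real t powr (2/3) + real t * c)"
      using q a c by (intro mult_right_mono) auto
    then show ?thesis by (simp add: algebra_simps)
  qed
  also have "q ^ Suc t * F y + a * real t powr (2/3) + real t * c + 2 * D / real T * sqrt b + c
      = q ^ Suc t * F y + a * (real t powr (2/3) + 2/3 * (real t + 2) powr (-1/3)) + real (Suc t) * c"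
    unfolding sb by (simp add: algebra_simps)
  also have "\<dots> \<le> q ^ Suc t * F y + a * real (Suc t) powr (2/3) + real (Suc t) * c"
    using powr_two_thirds_increment[of "real t"] a
    by (intro add_mono mult_left_mono order_refl) (auto simp: add.commute)
  finally show ?case by (simp add: q_def a_def c_def Q_def)
qed

lemma approximation_bound:
  assumes \<rho>: "\<rho> = (\<lambda>t. 4 / (real t + 8) powr (2/3))"
    and y: "y \<in> C" and nonneg: "\<And>y. y \<in> X \<Longrightarrow> 0 \<le> F y"
  shows "(1 - 1 / exp 1) * F y - 2 * D * sqrt (scg_Q gF L D \<sigma>) / real T powr (1/3)
    - L * D\<^sup>2 / (2 * real T) \<le> expectation (\<lambda>\<omega>. F (x T \<omega>))"
proof (cases "8 \<le> T")
  case True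
  have yX: "0 \<le> F y" using y C nonneg by auto
  have "1 - 1 / real T \<le> exp (- (1 / real T))" using exp_ge_add_one_self[of "- (1 / real T)"] by simp
  then have "(1 - 1 / real T) ^ T \<le> exp (- (1 / real T)) ^ T" using T by (intro power_mono) auto
  also have "\<dots> = exp (real T * - (1 / real T))" by (rule exp_of_nat_mult[symmetric])
  also have "\<dots> = 1 / exp 1" using T by (simp add: exp_minus inverse_eq_divide)
  finally have "(1 - 1 / real T) ^ T * F y \<le> 1 / exp 1 * F y" using yX by (rule mult_right_mono)
  moreover have "real T powr (2/3) / real T = 1 / real T powr (1/3)"
  proof -
    have "real T powr (2/3) * real T powr (1/3) = real T" using T by (simp add: powr_add[symmetric])
    then show ?thesis using T by (simp add: field_simps)
  qed
  then have "2 * D * sqrt (scg_Q gF L D \<sigma>) / real T * real T powr (2/3)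
      = 2 * D * sqrt (scg_Q gF L D \<sigma>) / real T powr (1/3)"
    by (metis times_divide_eq_left times_divide_eq_right mult.right_neutral)
  moreover have "real T * (L * D\<^sup>2 / (2 * (real T)\<^sup>2)) = L * D\<^sup>2 / (2 * real T)"
    using T by (simp add: power2_eq_square)
  ultimately show ?thesis
    using expected_gap[OF \<rho> True order_refl y nonneg[OF zero_in_X]] by (simp add: left_diff_distrib)
next
  case False
  define Q where "Q = scg_Q gF L D \<sigma>"
  have Q: "0 \<le> Q" by (simp add: Q_def scg_Q_nonneg)
  have "(norm (gF 0))\<^sup>2 \<le> 9 powr (2/3) * (norm (gF 0))\<^sup>2"
    using mult_right_mono[of 1 "9 powr (2/3)" "(norm (gF 0))\<^sup>2"] by (simp add: ge_one_powr_ge_zero)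
  also have "\<dots> \<le> Q" by (simp add: Q_def scg_Q_def)
  finally have g: "norm (gF 0) \<le> sqrt Q" by (rule real_le_rsqrt)
  have "F y - F 0 \<le> gF 0 \<bullet> y"
    using DR_submodular_gap[OF box(2) F_DR F_smooth F_mono zero_in_X] y C by auto
  also have "\<dots> \<le> norm (gF 0) * norm y" by (rule norm_cauchy_schwarz)
  also have "\<dots> \<le> sqrt Q * D" using g D[OF y] Q by (intro mult_mono) auto
  finally have gap: "F y \<le> F 0 + sqrt Q * D" by simp
  \<comment> \<open>For \<open>T < 8\<close> this is absorbed by the factor 2 in the error term, so
    the crude gap \<open>sqrt Q * D\<close> from the origin is already small enough.\<close>
  have "real T powr (1/3) \<le> 2"
    by (rule cube_le_imp_le) (use False in \<open>auto simp: powr_third_cube\<close>)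
  then have "D * sqrt Q * real T powr (1/3) \<le> D * sqrt Q * 2"
    using D_nonneg Q by (intro mult_left_mono) auto
  then have "sqrt Q * D \<le> 2 * D * sqrt Q / real T powr (1/3)"
    using T by (simp add: field_simps)
  moreover have "(1 - 1 / exp 1) * F y \<le> 1 * F y"
    using y C nonneg by (intro mult_right_mono) auto
  moreover have "0 \<le> L * D\<^sup>2 / (2 * real T)" using lipschitz_on_nonneg[OF F_smooth] by simp
  moreover have "F 0 \<le> expectation (\<lambda>\<omega>. F (x T \<omega>))"
  proof -
    have "F 0 \<le> F (x T \<omega>)" if "\<omega> \<in> space M" for \<omega>
      using x_in_X[OF order_refl that] zero_in_X
      by (intro mono_onD[OF F_mono]) (auto simp: box cbox_interval)
    then have "expectation (\<lambda>\<omega>. F 0) \<le> expectation (\<lambda>\<omega>. F (x T \<omega>))"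
      using F_x_integrable[of T] by (intro integral_mono) auto
    then show ?thesis by (simp add: prob_space)
  qed
  ultimately show ?thesis using gap by (simp add: Q_def)
qed

end

theorem theorem3:
  fixes u :: "real^'n"
    and X C :: "(real^'n) set"
    and F :: "real^'n \<Rightarrow> real" and gF :: "real^'n \<Rightarrow> real^'n"
    and Ft :: "real^'n \<Rightarrow> 'z \<Rightarrow> real" and gFt :: "real^'n \<Rightarrow> 'z \<Rightarrow> real^'n"
    and P :: "'z measure" and M :: "'w measure"
    and L D \<sigma> :: real and T :: nat
    and z :: "nat \<Rightarrow> 'w \<Rightarrow> 'z"
    and \<kappa> :: "nat \<Rightarrow> (nat \<Rightarrow> 'z) \<Rightarrow> real^'n"
    and d v x :: "nat \<Rightarrow> 'w \<Rightarrow> real^'n"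
  assumes box: "0 \<le> u" "X = cbox 0 u"
    and C: "C \<subseteq> X" "C \<noteq> {}" "compact C" "convex C"
    and D: "\<And>y. y \<in> C \<Longrightarrow> norm y \<le> D"
    and P: "prob_space P"
    and F_expectation: "\<And>y. y \<in> X \<Longrightarrow> has_bochner_integral P (Ft y) (F y)"
    and F_nonneg: "\<And>y. y \<in> X \<Longrightarrow> 0 \<le> F y"
    and F_mono: "mono_on X F"
    and F_DR: "DR_submodular_on X F gF"
    and F_smooth: "L-lipschitz_on X gF"
    and Ft_gradient: "\<And>\<zeta>. \<zeta> \<in> space P \<Longrightarrow> gradient_on X (\<lambda>y. Ft y \<zeta>) (\<lambda>y. gFt y \<zeta>)"
    and gFt_measurable:
      "(\<lambda>(y, \<zeta>). gFt y \<zeta>) \<in> borel_measurable (restrict_space borel X \<Otimes>\<^sub>M P)"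
    and unbiased: "\<And>y. y \<in> X \<Longrightarrow> has_bochner_integral P (gFt y) (gF y)"
    and variance_integrable:
      "\<And>y. y \<in> X \<Longrightarrow> integrable P (\<lambda>\<zeta>. (norm (gFt y \<zeta> - gF y))\<^sup>2)"
    and variance_bound:
      "\<And>y. y \<in> X \<Longrightarrow> (\<integral>\<zeta>. (norm (gFt y \<zeta> - gF y))\<^sup>2 \<partial>P) \<le> \<sigma>\<^sup>2"
    and M: "prob_space M"
    and z_indep: "prob_space.indep_vars M (\<lambda>_. P) z {1..}"
    and z_law: "\<And>t. 1 \<le> t \<Longrightarrow> distr M P (z t) = P"
    and T: "1 \<le> T"
    and ties_measurable: "\<And>t. t < T \<Longrightarrow> \<kappa> t \<in> borel_measurable (PiM {1..t} (\<lambda>_. P))"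
    and ties_past: "\<And>t \<omega>. t < T \<Longrightarrow> \<omega> \<in> space M \<Longrightarrow> v t \<omega> = \<kappa> t (\<lambda>s\<in>{1..t}. z s \<omega>)"
    and scg: "\<And>\<omega>. \<omega> \<in> space M \<Longrightarrow>
      scg_run gFt C T (\<lambda>t. 4 / (real t + 8) powr (2/3))
        (\<lambda>t. z t \<omega>) (\<lambda>t. d t \<omega>) (\<lambda>t. v t \<omega>) (\<lambda>t. x t \<omega>)"
  shows "integrable M (\<lambda>\<omega>. F (x T \<omega>)) \<and>
    (\<integral>\<omega>. F (x T \<omega>) \<partial>M) \<ge>
      (1 - 1 / exp 1) * (SUP y\<in>C. F y)
      - 2 * D * sqrt (scg_Q gF L D \<sigma>) / real T powr (1/3)
      - L * D\<^sup>2 / (2 * real T)"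
proof -
  interpret scg_process M u X C F gF gFt P L D \<sigma> T z \<kappa> d v x "\<lambda>t. 4 / (real t + 8) powr (2/3)"
    by (intro scg_process.intro scg_process_axioms.intro) (fact assms)+
  define e :: real where "e = 1 - 1 / exp 1"
  define K where "K = 2 * D * sqrt (scg_Q gF L D \<sigma>) / real T powr (1/3) + L * D\<^sup>2 / (2 * real T)"
  have e: "0 < e" by (simp add: e_def)
  \<comment> \<open>Dividing by \<open>e > 0\<close> gives an upper bound on \<open>F y\<close> that
    is free of \<open>y\<close> and so passes to the supremum.\<close>
  have "(SUP y\<in>C. F y) \<le> (expectation (\<lambda>\<omega>. F (x T \<omega>)) + K) / e"
  proof (rule cSUP_least[OF C(2)])
    fix y assume "y \<in> C"
    from approximation_bound[OF refl this F_nonneg]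
    have "F y * e \<le> expectation (\<lambda>\<omega>. F (x T \<omega>)) + K" by (simp add: e_def K_def mult.commute)
    then show "F y \<le> (expectation (\<lambda>\<omega>. F (x T \<omega>)) + K) / e" using e by (simp add: pos_le_divide_eq)
  qed
  then have "e * (SUP y\<in>C. F y) \<le> expectation (\<lambda>\<omega>. F (x T \<omega>)) + K"
    using e by (simp add: pos_le_divide_eq mult.commute)
  then show ?thesis using F_x_integrable[of T] by (simp add: e_def K_def)
qed

end
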